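(* Let $\sigma_N$ be the probability of stabilization of a cell in the uniform random Boolean cellular automaton of size $N$, and let $\sigma_*$ be the probability of stabilization of a cell in the infinite uniform random Boolean cellular automaton. Then $$\lim_{N\to\infty}\sigma_N=\sigma_*\quad\text{and}\quad \sigma_*>0.$$
   Context: Boolean rules: $\varphi_0,\dots,\varphi_{15}$ denote the 16 functions $\{0,1\}^2\to\{0,1\}$. Uniform random Boolean cellular automaton (RBCA) of infinite size: the cells are the integers $i\in\mathbb{Z}$; the rules $(\Phi_i)_{i\in\mathbb{Z}}$ are i.i.d. and uniform, i.e. $\Phi_i=\varphi_j$ with probability $1/16$ for each $j=0,\dots,15$; the initial states $(X_i(0))_{i\in\mathbb{Z}}$ are i.i.d. Bernoulli$(1/2)$ with values in $\{0,1\}$ and independent of the rules. The rules are fixed in time and the states evolve for $t=0,1,2,\dots$ by $$X_i(t+1)=\Phi_i\big(X_{i-1}(t),X_{i+1}(t)\big).$$ The resulting probability measure is $\mathbb{P}_*$. Uniform RBCA of size $N$: the same, but on a circle of $N$ cells, i.e. the rules $\Phi_1,\dots,\Phi_N$ of the $N$ cells $1,\dots,N$ are i.i.d. with $\Phi_i=\varphi_j$ with probability $1/16$ for each $j=0,\dots,15$, the initial states $X_1(0),\dots,X_N(0)$ are i.i.d. Bernoulli$(1/2)$ with values in $\{0,1\}$ and independent of the rules, indices are extended to $\mathbb{Z}$ periodically with period $N$ ($X_{i+kN}=X_i$, $\Phi_{i+kN}=\Phi_i$), and the rules are fixed in time and the states evolve for $t=0,1,2,\dots$ by the same evolution equation $X_i(t+1)=\Phi_i\big(X_{i-1}(t),X_{i+1}(t)\big)$.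 The resulting probability measure is $\mathbb{P}_N$. Cell $i$ stabilizes if there is a $T$ such that $X_i(t)=X_i(T)$ for all $t\ge T$. By stationarity the probability of this does not depend on $i$; $\sigma_N=\mathbb{P}_N(\text{cell }0\text{ stabilizes})$ and $\sigma_*=\mathbb{P}_*(\text{cell }0\text{ stabilizes})$. *)

theory Defs
  imports "HOL-Probability.Probability"
begin

text \<open>
  The states 0 and 1 are represented by \<^term>\<open>False\<close> and \<^term>\<open>True\<close>, so the 16 functions from
  pairs of states to states are all the elements of the type \<open>rule\<close>.
\<close>

type_synonym rule = "bool \<times> bool \<Rightarrow> bool"

primrec evolve :: "(int \<Rightarrow> rule) \<Rightarrow> (int \<Rightarrow> bool) \<Rightarrow> nat \<Rightarrow> int \<Rightarrow> bool" where
  "evolve \<Phi> x 0 = x"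
| "evolve \<Phi> x (Suc t) = (\<lambda>i. \<Phi> i (evolve \<Phi> x t (i - 1), evolve \<Phi> x t (i + 1)))"

definition stabilizes :: "(int \<Rightarrow> rule) \<Rightarrow> (int \<Rightarrow> bool) \<Rightarrow> int \<Rightarrow> bool" where
  "stabilizes \<Phi> x i \<longleftrightarrow> (\<exists>T. \<forall>t\<ge>T. evolve \<Phi> x t i = evolve \<Phi> x T i)"

definition rbca :: "int set \<Rightarrow> ((int \<Rightarrow> rule) \<times> (int \<Rightarrow> bool)) measure" where
  "rbca I = (\<Pi>\<^sub>M i\<in>I. measure_pmf (pmf_of_set (UNIV :: rule set)))
        \<Otimes>\<^sub>M (\<Pi>\<^sub>M i\<in>I. measure_pmf (bernoulli_pmf (1 / 2)))"

text \<open>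
  On the circle, only the cells \<open>1, \<dots>, N\<close> carry randomness; the index \<open>i\<close> is reduced to its
  representative modulo \<open>N\<close> in that range. The value at \<open>N = 0\<close> is irrelevant.
\<close>

definition periodic :: "nat \<Rightarrow> (int \<Rightarrow> 'a) \<Rightarrow> int \<Rightarrow> 'a" where
  "periodic N f i = f ((i - 1) mod int N + 1)"

definition sigma_circle :: "nat \<Rightarrow> real" where
  "sigma_circle N = measure (rbca {1..int N})
     {\<omega> \<in> space (rbca {1..int N}). stabilizes (periodic N (fst \<omega>)) (periodic N (snd \<omega>)) 0}"

definition sigma_star :: real where
  "sigma_star = measure (rbca UNIV) {\<omega> \<in> space (rbca UNIV). stabilizes (fst \<omega>) (snd \<omega>) 0}"

lemma pmf_uniform_rule: "pmf (pmf_of_set (UNIV :: rule set)) \<phi> = 1 / 16"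
  by (simp add: card_fun)

lemma prob_space_rbca: "prob_space (rbca I)"
proof -
  interpret R: prob_space "\<Pi>\<^sub>M i\<in>I. measure_pmf (pmf_of_set (UNIV :: rule set))"
    by (intro prob_space_PiM prob_space_measure_pmf)
  interpret S: prob_space "\<Pi>\<^sub>M i\<in>I. measure_pmf (bernoulli_pmf (1 / 2))"
    by (intro prob_space_PiM prob_space_measure_pmf)
  interpret pair_prob_space "\<Pi>\<^sub>M i\<in>I. measure_pmf (pmf_of_set (UNIV :: rule set))"
    "\<Pi>\<^sub>M i\<in>I. measure_pmf (bernoulli_pmf (1 / 2))" ..
  show ?thesis
    unfolding rbca_def by (rule prob_space_axioms)
qed

lemma measurable_evolve:
  assumes "\<And>i. (\<lambda>\<omega>. \<Phi> \<omega> i) \<in> M \<rightarrow>\<^sub>M count_space UNIV"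
    and "\<And>i. (\<lambda>\<omega>. x \<omega> i) \<in> M \<rightarrow>\<^sub>M count_space UNIV"
  shows "(\<lambda>\<omega>. evolve (\<Phi> \<omega>) (x \<omega>) t i) \<in> M \<rightarrow>\<^sub>M count_space UNIV"
proof (induction t arbitrary: i)
  case (Suc t i)
  show ?case
    unfolding evolve.simps
  proof (rule measurable_compose_countable[where g = "\<lambda>\<omega>. \<Phi> \<omega> i" and
      f = "\<lambda>\<phi> \<omega>. \<phi> (evolve (\<Phi> \<omega>) (x \<omega>) t (i - 1), evolve (\<Phi> \<omega>) (x \<omega>) t (i + 1))"])
    fix \<phi> :: rule
    have "(\<lambda>\<omega>. \<phi> (p \<omega>, q \<omega>)) \<in> M \<rightarrow>\<^sub>M count_space UNIV"
      if [measurable]: "Measurable.pred M p" "Measurable.pred M q" for p q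
    proof -
      have "(\<lambda>\<omega>. \<phi> (p \<omega>, q \<omega>)) =
        (\<lambda>\<omega>. (p \<omega> \<and> q \<omega> \<and> \<phi> (True, True)) \<or> (p \<omega> \<and> \<not> q \<omega> \<and> \<phi> (True, False)) \<or>
             (\<not> p \<omega> \<and> q \<omega> \<and> \<phi> (False, True)) \<or> (\<not> p \<omega> \<and> \<not> q \<omega> \<and> \<phi> (False, False)))"
        by (rule ext) (metis (full_types))
      then show ?thesis by simp
    qed
    then show "(\<lambda>\<omega>. \<phi> (evolve (\<Phi> \<omega>) (x \<omega>) t (i - 1), evolve (\<Phi> \<omega>) (x \<omega>) t (i + 1)))
        \<in> M \<rightarrow>\<^sub>M count_space UNIV"
      using Suc by blast
  qed (rule assms)
qed (simp add: assms)

lemma measurable_stabilizes: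
  assumes "\<And>i. (\<lambda>\<omega>. \<Phi> \<omega> i) \<in> M \<rightarrow>\<^sub>M count_space UNIV"
    and "\<And>i. (\<lambda>\<omega>. x \<omega> i) \<in> M \<rightarrow>\<^sub>M count_space UNIV"
  shows "{\<omega> \<in> space M. stabilizes (\<Phi> \<omega>) (x \<omega>) i} \<in> sets M"
proof -
  note [measurable] = measurable_evolve[OF assms]
  show ?thesis
    unfolding stabilizes_def by measurable
qed

lemma measurable_rbca_component:
  assumes "i \<in> I"
  shows "(\<lambda>\<omega>. fst \<omega> i) \<in> rbca I \<rightarrow>\<^sub>M count_space UNIV"
    and "(\<lambda>\<omega>. snd \<omega> i) \<in> rbca I \<rightarrow>\<^sub>M count_space UNIV"
proof -
  have "(\<lambda>\<omega>. fst \<omega> i) \<in> rbca I \<rightarrow>\<^sub>M measure_pmf (pmf_of_set UNIV)"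
    unfolding rbca_def using assms
    by (intro measurable_compose[OF measurable_fst] measurable_component_singleton)
  then show "(\<lambda>\<omega>. fst \<omega> i) \<in> rbca I \<rightarrow>\<^sub>M count_space UNIV"
    by (simp add: measurable_def)
  have "(\<lambda>\<omega>. snd \<omega> i) \<in> rbca I \<rightarrow>\<^sub>M measure_pmf (bernoulli_pmf (1 / 2))"
    unfolding rbca_def using assms
    by (intro measurable_compose[OF measurable_snd] measurable_component_singleton)
  then show "(\<lambda>\<omega>. snd \<omega> i) \<in> rbca I \<rightarrow>\<^sub>M count_space UNIV"
    by (simp add: measurable_def)
qed

lemma sets_stabilizes_star:
  "{\<omega> \<in> space (rbca UNIV). stabilizes (fst \<omega>) (snd \<omega>) i} \<in> sets (rbca UNIV)"
  by (intro measurable_stabilizes measurable_rbca_component UNIV_I)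

lemma sets_stabilizes_circle:
  assumes "N > 0"
  shows "{\<omega> \<in> space (rbca {1..int N}). stabilizes (periodic N (fst \<omega>)) (periodic N (snd \<omega>)) i}
    \<in> sets (rbca {1..int N})"
proof -
  have "(j - 1) mod int N + 1 \<in> {1..int N}" for j :: int
    using assms by (simp add: add1_zle_eq)
  then show ?thesis
    unfolding periodic_def by (intro measurable_stabilizes measurable_rbca_component)
qed

end

theory Submission
  imports Defs
begin

text \<open>
  A cell with a constant rule is a wall: from time 1 on its state is fixed, whatever its neighbours
  do. Two facts follow.

  A wall stabilizes, and a cell is a wall with positive probability, so \<open>\<sigma>\<^sub>* > 0\<close>.

  A wall also stops information. The evolution of a segment whose two end cells are walls is a
  function of the rules and initial states inside the segment (\<open>evolve_cong_between_walls\<close>). On the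
  infinite line there is almost surely a wall on either side of cell 0 (\<open>AE_ex_wall\<close>), so the
  stabilization of cell 0 depends on a finite, though random, window around it. This allows a
  coupling of all circles with the line: cutting the circle of size \<open>N\<close> opposite to cell 0 and
  laying it on the line gives an injection \<open>centred N\<close> of its cells into the integers, and reading
  the rules and states of the line through this injection gives exactly the RBCA of size \<open>N\<close>
  (\<open>sigma_circle_coupling\<close>). As soon as \<open>N\<close> is so large that the window
  does not meet the cut, cell 0 stabilizes on the circle iff it does so on the line. Hence the
  indicators of stabilization on the coupled circles converge almost surely to the one on the line,
  and so do their expectations, by dominated convergence.
\<close>

section \<open>Walls\<close>

definition wall :: "rule \<Rightarrow> bool" where
  "wall \<phi> \<longleftrightarrow> (\<forall>u v. \<phi> u = \<phi> v)"

lemma stabilizes_wall: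
  assumes "wall (\<Phi> i)"
  shows "stabilizes \<Phi> x i"
proof -
  have "evolve \<Phi> x t i = evolve \<Phi> x 1 i" if "t \<ge> 1" for t
    using that assms unfolding wall_def by (cases t) auto
  then show ?thesis
    unfolding stabilizes_def by blast
qed

text \<open>
  Inside the segment a step only reads cells of the segment; at the two ends the new state does not
  depend on what is read.
\<close>

lemma evolve_cong_between_walls:
  assumes walls: "wall (\<Phi> a)" "wall (\<Phi> b)"
    and rules: "\<And>j. j \<in> {a..b} \<Longrightarrow> \<Phi>' j = \<Phi> j"
    and states: "\<And>j. j \<in> {a..b} \<Longrightarrow> x' j = x j"
    and "i \<in> {a..b}"
  shows "evolve \<Phi>' x' t i = evolve \<Phi> x t i"
  using \<open>i \<in> {a..b}\<close>
proof (induction t arbitrary: i)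
  case 0
  then show ?case by (simp add: states)
next
  case (Suc t)
  show ?case
  proof (cases "i = a \<or> i = b")
    case True
    then have "wall (\<Phi> i)" using walls by blast
    then show ?thesis
      unfolding wall_def using rules[OF Suc.prems] by simp
  next
    case False
    then have "i - 1 \<in> {a..b}" "i + 1 \<in> {a..b}" using Suc.prems by auto
    then show ?thesis using Suc.IH rules[OF Suc.prems] by simp
  qed
qed

lemma stabilizes_cong_between_walls:
  assumes "wall (\<Phi> a)" "wall (\<Phi> b)"
    and "\<And>j. j \<in> {a..b} \<Longrightarrow> \<Phi>' j = \<Phi> j"
    and "\<And>j. j \<in> {a..b} \<Longrightarrow> x' j = x j"
    and "i \<in> {a..b}"
  shows "stabilizes \<Phi>' x' i \<longleftrightarrow> stabilizes \<Phi> x i"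
  unfolding stabilizes_def using evolve_cong_between_walls[OF assms] by simp


section \<open>Walls on the random line\<close>

abbreviation rules_measure :: "int set \<Rightarrow> (int \<Rightarrow> rule) measure" where
  "rules_measure I \<equiv> \<Pi>\<^sub>M i\<in>I. measure_pmf (pmf_of_set UNIV)"

abbreviation states_measure :: "int set \<Rightarrow> (int \<Rightarrow> bool) measure" where
  "states_measure I \<equiv> \<Pi>\<^sub>M i\<in>I. measure_pmf (bernoulli_pmf (1 / 2))"

lemma prob_space_rules_measure: "prob_space (rules_measure I)"
  by (intro prob_space_PiM prob_space_measure_pmf)

lemma prob_space_states_measure: "prob_space (states_measure I)"
  by (intro prob_space_PiM prob_space_measure_pmf)

lemma distr_fst_rbca: "distr (rbca I) (rules_measure I) fst = rules_measure I"
  unfolding rbca_def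
  by (intro prob_space.distr_pair_fst prob_space_states_measure)

lemma prob_wall_pos: "measure_pmf.prob (pmf_of_set UNIV) {\<phi>. wall \<phi>} > 0"
proof -
  have "(\<lambda>_. True) \<in> {\<phi>. wall \<phi>}"
    by (simp add: wall_def)
  then have "card {\<phi>. wall \<phi>} > 0"
    by (metis card_gt_0_iff empty_iff finite)
  then show ?thesis
    by (simp add: measure_pmf_of_set)
qed

lemma prob_rules_measure:
  assumes "finite J"
  shows "measure (rules_measure UNIV) {\<Phi> \<in> space (rules_measure UNIV). \<forall>i\<in>J. \<Phi> i \<in> A}
    = measure_pmf.prob (pmf_of_set UNIV) A ^ card J"
proof -
  let ?p = "pmf_of_set (UNIV :: rule set)"
  interpret product_prob_space "\<lambda>_::int. measure_pmf ?p" UNIV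
    by (intro product_prob_spaceI prob_space_measure_pmf)
  have "emeasure (rules_measure UNIV) {\<Phi> \<in> space (rules_measure UNIV). \<forall>i\<in>J. \<Phi> i \<in> A}
      = ennreal (measure_pmf.prob ?p A ^ card J)"
    using assms emeasure_PiM_Collect[of J "\<lambda>_. A"]
    by (simp add: measure_pmf.emeasure_eq_measure ennreal_power)
  then show ?thesis
    by (simp add: measure_def)
qed

text \<open>
  If no wall occurs along \<open>g\<close>, then none occurs among the first \<open>n\<close> cells of \<open>g\<close>. These are distinct,
  so by independence this has probability \<open>(1 - p) ^ n\<close>, where \<open>p > 0\<close> is the probability of a wall.
\<close>

lemma AE_ex_wall:
  fixes g :: "nat \<Rightarrow> int"
  assumes "inj g"
  shows "AE \<omega> in rbca UNIV. \<exists>n. wall (fst \<omega> (g n))"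
proof -
  let ?R = "rules_measure UNIV"
  interpret R: prob_space ?R by (rule prob_space_rules_measure)
  define q where "q = measure_pmf.prob (pmf_of_set UNIV) {\<phi>. \<not> wall \<phi>}"
  have "q = 1 - measure_pmf.prob (pmf_of_set UNIV) {\<phi>. wall \<phi>}"
    unfolding q_def using measure_pmf.prob_compl[of "{\<phi>. wall \<phi>}" "pmf_of_set UNIV"]
    by (simp add: Compl_eq_Diff_UNIV[symmetric] Collect_neg_eq)
  then have "q < 1" using prob_wall_pos by simp
  have "q \<ge> 0" by (simp add: q_def)
  define B where "B = {\<Phi> \<in> space ?R. \<forall>n. \<not> wall (\<Phi> (g n))}"
  have [measurable]: "Measurable.pred ?R (\<lambda>\<Phi>. wall (\<Phi> i))" for i
    using measurable_compose[OF measurable_component_singleton[of i UNIV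
        "\<lambda>_. measure_pmf (pmf_of_set UNIV)"], of wall "count_space UNIV"] by simp
  have B: "B \<in> sets ?R" unfolding B_def by measurable
  have "measure ?R B \<le> q ^ n" for n
  proof -
    have "measure ?R B
        \<le> measure ?R {\<Phi> \<in> space ?R. \<forall>i\<in>g ` {..<n}. \<Phi> i \<in> {\<phi>. \<not> wall \<phi>}}"
    proof (rule R.finite_measure_mono)
      show "{\<Phi> \<in> space ?R. \<forall>i\<in>g ` {..<n}. \<Phi> i \<in> {\<phi>. \<not> wall \<phi>}} \<in> sets ?R"
        unfolding mem_Collect_eq by measurable
    qed (auto simp: B_def)
    also have "\<dots> = q ^ n"
      using assms by (subst prob_rules_measure) (simp_all add: q_def card_image inj_on_subset)
    finally show ?thesis .
  qed
  moreover have "(\<lambda>n. q ^ n) \<longlonglongrightarrow> 0"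
    using \<open>0 \<le> q\<close> \<open>q < 1\<close> by (rule LIMSEQ_realpow_zero)
  ultimately have "measure ?R B \<le> 0"
    by (intro LIMSEQ_le_const) auto
  then have "emeasure ?R B = 0"
    by (simp add: R.emeasure_eq_measure measure_le_0_iff)
  then have "AE \<Phi> in ?R. \<exists>n. wall (\<Phi> (g n))"
    using B by (intro AE_I[of _ _ B]) (auto simp: B_def)
  then have "AE \<Phi> in distr (rbca UNIV) ?R fst. \<exists>n. wall (\<Phi> (g n))"
    by (simp only: distr_fst_rbca)
  then show ?thesis
    by (subst (asm) AE_distr_iff) (auto simp: rbca_def)
qed

lemma sigma_star_pos: "sigma_star > 0"
proof -
  let ?R = "rules_measure UNIV"
  let ?W = "{\<Phi> \<in> space ?R. \<forall>i\<in>{0}. \<Phi> i \<in> {\<phi>. wall \<phi>}}"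
  interpret prob_space "rbca UNIV" by (rule prob_space_rbca)
  have fst: "fst \<in> rbca UNIV \<rightarrow>\<^sub>M ?R" by (simp add: rbca_def)
  have W: "?W \<in> sets ?R" by measurable
  have "0 < measure ?R ?W"
    using prob_wall_pos by (subst prob_rules_measure) simp_all
  also have "\<dots> = prob (fst -` ?W \<inter> space (rbca UNIV))"
    using measure_distr[OF fst W] by (simp only: distr_fst_rbca)
  also have "\<dots> \<le> sigma_star"
    unfolding sigma_star_def
    by (intro finite_measure_mono sets_stabilizes_star) (auto intro: stabilizes_wall)
  finally show ?thesis .
qed


section \<open>Coupling the circles with the line\<close>

text \<open>
  The representative modulo \<open>N\<close> that lies in the window of \<open>N\<close> consecutive integers around 0.
\<close>

definition centred :: "nat \<Rightarrow> int \<Rightarrow> int" where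
  "centred N j = (j + int N div 2) mod int N - int N div 2"

lemma centred_periodic: "centred N ((j - 1) mod int N + 1) = centred N j"
proof -
  have "((j - 1) mod int N + 1 + int N div 2) mod int N = (j + int N div 2) mod int N"
    using mod_add_left_eq[of "j - 1" "int N" "1 + int N div 2"] by (simp add: algebra_simps)
  then show ?thesis by (simp add: centred_def)
qed

lemma centred_eq_self:
  assumes "2 * \<bar>j\<bar> < int N - 1"
  shows "centred N j = j"
  unfolding centred_def using assms by (subst mod_pos_pos_trivial) auto

lemma inj_on_centred: "inj_on (centred N) {1..int N}"
proof (rule inj_onI)
  fix i j assume ij: "i \<in> {1..int N}" "j \<in> {1..int N}" and "centred N i = centred N j"
  then have "(i + int N div 2) mod int N = (j + int N div 2) mod int N"
    by (simp add: centred_def)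
  then have "int N dvd i - j"
    by (simp add: mod_eq_dvd_iff)
  moreover have "\<bar>i - j\<bar> < int N" using ij by auto
  ultimately show "i = j"
    using dvd_imp_le_int[of "i - j" "int N"] by fastforce
qed

text \<open>
  The coupling map. It is restricted to the cells \<open>1, \<dots>, N\<close> because the configurations of the
  circle form a product space over exactly these indices.
\<close>

definition pull_back :: "nat \<Rightarrow> (int \<Rightarrow> 'a) \<Rightarrow> int \<Rightarrow> 'a" where
  "pull_back N f = (\<lambda>i\<in>{1..int N}. f (centred N i))"

lemma periodic_pull_back:
  assumes "N > 0"
  shows "periodic N (pull_back N f) = f \<circ> centred N"
  using assms by (auto simp: fun_eq_iff periodic_def pull_back_def centred_periodic add1_zle_eq)

text \<open>
  An i.i.d. family read through an injection of the index sets is again i.i.d.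
\<close>

lemma distr_pull_back:
  assumes "prob_space M"
  shows "distr (\<Pi>\<^sub>M i\<in>UNIV. M) (\<Pi>\<^sub>M i\<in>{1..int N}. M) (pull_back N) = (\<Pi>\<^sub>M i\<in>{1..int N}. M)"
  using distr_PiM_reindex[of UNIV "\<lambda>_. M" "centred N" "{1..int N}"] assms inj_on_centred[of N]
  by (simp add: pull_back_def[abs_def])

lemma measurable_pull_back:
  "pull_back N \<in> (\<Pi>\<^sub>M i\<in>UNIV. M) \<rightarrow>\<^sub>M (\<Pi>\<^sub>M i\<in>{1..int N}. M)"
  unfolding pull_back_def[abs_def]
  by (intro measurable_restrict measurable_component_singleton UNIV_I)

lemma distr_rbca_pull_back:
  "distr (rbca UNIV) (rbca {1..int N}) (map_prod (pull_back N) (pull_back N)) = rbca {1..int N}"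
proof -
  let ?K = "{1..int N}"
  have "distr (rules_measure UNIV) (rules_measure ?K) (pull_back N)
        \<Otimes>\<^sub>M distr (states_measure UNIV) (states_measure ?K) (pull_back N)
      = distr (rbca UNIV) (rbca ?K) (\<lambda>(\<Phi>, x). (pull_back N \<Phi>, pull_back N x))"
    unfolding rbca_def
    by (intro pair_measure_distr measurable_pull_back)
      (simp add: distr_pull_back prob_space_measure_pmf prob_space_states_measure
        prob_space_imp_sigma_finite)
  then show ?thesis
    by (simp add: distr_pull_back prob_space_measure_pmf rbca_def map_prod_def)
qed

lemma sigma_circle_coupling:
  assumes "N > 0"
  shows "sigma_circle N = measure (rbca UNIV)
    {\<omega> \<in> space (rbca UNIV). stabilizes (fst \<omega> \<circ> centred N) (snd \<omega> \<circ> centred N) 0}"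
proof -
  let ?C = "rbca {1..int N}"
  let ?pull = "map_prod (pull_back N) (pull_back N)"
  let ?S = "{\<omega> \<in> space ?C. stabilizes (periodic N (fst \<omega>)) (periodic N (snd \<omega>)) 0}"
  have pull: "?pull \<in> rbca UNIV \<rightarrow>\<^sub>M ?C"
    unfolding rbca_def map_prod_def case_prod_beta
    by (intro measurable_Pair measurable_compose[OF measurable_fst]
        measurable_compose[OF measurable_snd] measurable_pull_back)
  have "sigma_circle N = measure (distr (rbca UNIV) ?C ?pull) ?S"
    by (simp only: sigma_circle_def distr_rbca_pull_back)
  also have "\<dots> = measure (rbca UNIV) (?pull -` ?S \<inter> space (rbca UNIV))"
    by (rule measure_distr[OF pull sets_stabilizes_circle[OF assms]])
  also have "?pull -` ?S \<inter> space (rbca UNIV)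
      = {\<omega> \<in> space (rbca UNIV). stabilizes (fst \<omega> \<circ> centred N) (snd \<omega> \<circ> centred N) 0}"
    using measurable_space[OF pull] by (auto simp: periodic_pull_back[OF assms])
  finally show ?thesis .
qed


section \<open>Convergence\<close>

text \<open>
  Between the two walls, \<open>centred N\<close> is the identity for all large \<open>N\<close>.
\<close>

lemma eventually_stabilizes_centred:
  assumes "wall (\<Phi> (- int m))" "wall (\<Phi> (int n))"
  shows "\<forall>\<^sub>F N in sequentially.
    stabilizes (\<Phi> \<circ> centred N) (x \<circ> centred N) 0 \<longleftrightarrow> stabilizes \<Phi> x 0"
proof (rule eventually_sequentiallyI)
  \<comment> \<open>the bound makes \<open>m\<close> and \<open>n\<close> both smaller than \<open>(N - 1) / 2\<close>, so that the segment avoids the cut\<close>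
  fix N :: nat assume N: "2 * (m + n) + 2 \<le> N"
  have "centred N j = j" if "j \<in> {- int m..int n}" for j
    using that N by (intro centred_eq_self) auto
  then show "stabilizes (\<Phi> \<circ> centred N) (x \<circ> centred N) 0 \<longleftrightarrow> stabilizes \<Phi> x 0"
    by (intro stabilizes_cong_between_walls[OF assms]) auto
qed

lemma sigma_circle_tendsto: "sigma_circle \<longlonglongrightarrow> sigma_star"
proof -
  let ?L = "rbca UNIV"
  interpret prob_space ?L by (rule prob_space_rbca)
  define A where
    "A N = {\<omega> \<in> space ?L. stabilizes (fst \<omega> \<circ> centred N) (snd \<omega> \<circ> centred N) 0}" for N
  define B where "B = {\<omega> \<in> space ?L. stabilizes (fst \<omega>) (snd \<omega>) 0}"
  have A [measurable]: "A N \<in> events" for N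
    unfolding A_def comp_def by (intro measurable_stabilizes measurable_rbca_component UNIV_I)
  have B [measurable]: "B \<in> events"
    unfolding B_def by (rule sets_stabilizes_star)
  have "AE \<omega> in ?L. (\<lambda>N. indicat_real (A N) \<omega>) \<longlonglongrightarrow> indicat_real B \<omega>"
  proof -
    have "AE \<omega> in ?L. \<exists>n. wall (fst \<omega> (- int n))" "AE \<omega> in ?L. \<exists>n. wall (fst \<omega> (int n))"
      by (intro AE_ex_wall injI; simp)+
    then show ?thesis
    proof eventually_elim
      case (elim \<omega>)
      then obtain m n where "wall (fst \<omega> (- int m))" "wall (fst \<omega> (int n))" by blast
      from eventually_stabilizes_centred[OF this, of "snd \<omega>"]
      have "\<forall>\<^sub>F N in sequentially. indicat_real (A N) \<omega> = indicat_real B \<omega>"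
        by eventually_elim (simp add: A_def B_def indicator_def)
      then show ?case by (rule tendsto_eventually)
    qed
  qed
  then have "(\<lambda>N. expectation (indicat_real (A N))) \<longlonglongrightarrow> expectation (indicat_real B)"
    by (intro integral_dominated_convergence[where w = "\<lambda>_. 1"]) (auto simp: indicator_def)
  then have "(\<lambda>N. prob (A N)) \<longlonglongrightarrow> sigma_star"
    by (simp add: sigma_star_def B_def[symmetric])
  moreover have "\<forall>\<^sub>F N in sequentially. prob (A N) = sigma_circle N"
    using eventually_gt_at_top[of 0] by eventually_elim (simp add: A_def sigma_circle_coupling)
  ultimately show ?thesis
    by (rule Lim_transform_eventually)
qed

theorem proposition2:
  shows "sigma_circle \<longlonglongrightarrow> sigma_star \<and> sigma_star > 0"
  using sigma_circle_tendsto sigma_star_pos by blast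

end
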